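(* For every real $a>0$, $$S(a)=2\sum_{n=1}^\infty\tau(n)\int_0^\infty\frac{\cos t}{t+\frac{2n\pi}{a}}\,dt,$$ where $\tau(n)$ is the number of positive divisors of $n$.
   Context: Let $\psi(u)=\frac{d\ln\Gamma(u)}{du}$ be the digamma function. For real $a>0$ define $$S(a)=\sum_{n=1}^\infty\left[\ln\frac{n}{a}-\frac{a}{2n}-\psi\left(\frac{n}{a}\right)\right].$$ The integrals $\int_0^\infty\frac{\cos t}{t+2n\pi/a}\,dt$ are understood as (conditionally convergent) improper integrals $\lim_{R\to\infty}\int_0^R$. *)

theory Defs
  imports "HOL-Analysis.Analysis"
begin

definition divisor_count :: "nat \<Rightarrow> nat" where
  "divisor_count n = card {d. d dvd n}"

text \<open>Improper integrals over \<open>[0,\<infinity>)\<close>, allowing conditional convergence.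
  The limit operator on its own returns an unspecified value for a divergent integral, so
  convergence is a separate predicate.\<close>

definition improper_integral_converges :: "(real \<Rightarrow> real) \<Rightarrow> bool" where
  "improper_integral_converges f \<longleftrightarrow>
     (\<forall>R\<ge>0. f integrable_on {0..R}) \<and>
     (\<exists>L. ((\<lambda>R. integral {0..R} f) \<longlongrightarrow> L) at_top)"

definition improper_integral :: "(real \<Rightarrow> real) \<Rightarrow> real" where
  "improper_integral f = Lim at_top (\<lambda>R. integral {0..R} f)"

definition S_term :: "real \<Rightarrow> nat \<Rightarrow> real" where
  "S_term a n = ln (real n / a) - a / (2 * real n) - Digamma (real n / a)"

text \<open>Series over \<open>n \<ge> 1\<close> are indexed by \<open>Suc n\<close> with \<open>n\<close> ranging over all naturals.\<close>

definition S :: "real \<Rightarrow> real" where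
  "S a = (\<Sum>n. S_term a (Suc n))"

definition cos_integrand :: "real \<Rightarrow> nat \<Rightarrow> real \<Rightarrow> real" where
  "cos_integrand a n t = cos t / (t + 2 * real n * pi / a)"

end

(* By absolute convergence it suffices to show, for x > 0,
     ln x - 1/(2x) - psi(x) = 2 * sum_{m>=1} g(2 pi m x),   g(z) = int_0^oo cos t / (t + z) dt,
   where |g(z)| <= 2/z^2 (integrate by parts twice); one then sets x = n/a, sums over n and collects
   the pairs (n, m) according to N = n m.
   Both sides of the displayed identity tend to 0 along x, x+1, x+2, ... and have the same increments.
   On the right, periodicity of the cosine gives g(2 pi m x) - g(2 pi m (x+1)) = int_0^1 cos(2 pi m t)/(t+x) dt,
   and the sum of these Fourier coefficients is the trapezoid error of 1/(t+x) on [0,1]; on the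
   left the trapezoid errors telescope against the limit formula for the digamma function.
   The Fourier sum is evaluated by subtracting from 1/(t+x) its chord on [0,1]: the difference
   vanishes at both ends, so against the Dirichlet kernel the Riemann-Lebesgue lemma applies. *)

theory Submission
  imports Defs "HOL-Real_Asymp.Real_Asymp"
begin

section \<open>Oscillatory integrals and the Dirichlet kernel\<close>

text \<open>Replacing \<open>h\<close> by a uniformly close polynomial costs at most
  \<open>\<delta> * (b - a)\<close>, whatever the frequency; for the polynomial, one integration by
  parts gives decay of order 1/\<omega>.\<close>

lemma riemann_lebesgue_sin:
  fixes h :: "real \<Rightarrow> real"
  assumes "a \<le> b" and cont: "continuous_on {a..b} h"
  shows "((\<lambda>\<omega>. integral {a..b} (\<lambda>t. h t * sin (\<omega> * t))) \<longlongrightarrow> 0) at_top"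
proof (rule tendstoI)
  fix e :: real assume "e > 0"
  \<comment> \<open>The \<open>+ 1\<close> keeps the denominator positive when \<open>a = b\<close>
    and makes \<open>\<delta> * (b - a)\<close> strictly less than \<open>e / 2\<close>.\<close>
  define \<delta> where "\<delta> = e / (2 * (b - a + 1))"
  have "\<delta> > 0" using \<open>e > 0\<close> \<open>a \<le> b\<close> by (simp add: \<delta>_def)
  obtain p where p: "real_polynomial_function p" "\<And>t. t \<in> {a..b} \<Longrightarrow> \<bar>h t - p t\<bar> < \<delta>"
    using Stone_Weierstrass_real_polynomial_function[OF compact_Icc cont \<open>\<delta> > 0\<close>] by auto
  obtain p' where p': "real_polynomial_function p'" "\<And>t. (p has_real_derivative p' t) (at t)"
    using has_real_derivative_polynomial_function[OF p(1)] by blast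
  have contp: "continuous_on A p" "continuous_on A p'" for A
    using p(1) p'(1) continuous_on_polymonial_function real_polynomial_function_eq by blast+
  obtain B where B: "\<And>t. t \<in> {a..b} \<Longrightarrow> \<bar>p' t\<bar> \<le> B"
    using compact_imp_bounded[OF compact_continuous_image[OF contp(2)[of "{a..b}"] compact_Icc]]
    by (fastforce simp: bounded_iff)
  have "B \<ge> 0" using B[of a] \<open>a \<le> b\<close> by auto
  define C where "C = \<bar>p a\<bar> + \<bar>p b\<bar> + B * (b - a)"
  have bound_p: "\<bar>integral {a..b} (\<lambda>t. p t * sin (\<omega> * t))\<bar> \<le> C / \<omega>" if "\<omega> > 0" for \<omega>
  proof -
    have ibp: "((\<lambda>t. p t * sin (\<omega> * t) - p' t * cos (\<omega> * t) / \<omega>) has_integral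
        (- p b * cos (\<omega> * b) / \<omega> - (- p a * cos (\<omega> * a) / \<omega>))) {a..b}"
    proof (rule fundamental_theorem_of_calculus[OF \<open>a \<le> b\<close>])
      fix t
      have "((\<lambda>t. - p t * cos (\<omega> * t) / \<omega>) has_real_derivative
          (- p' t * cos (\<omega> * t) - p t * (- sin (\<omega> * t) * \<omega>)) / \<omega>) (at t within {a..b})"
        using that by (auto intro!: derivative_eq_intros DERIV_subset[OF p'(2)] simp: field_simps)
      also have "(- p' t * cos (\<omega> * t) - p t * (- sin (\<omega> * t) * \<omega>)) / \<omega> =
          p t * sin (\<omega> * t) - p' t * cos (\<omega> * t) / \<omega>"
        using that by (simp add: field_simps)
      finally show "((\<lambda>t. - p t * cos (\<omega> * t) / \<omega>) has_vector_derivative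
          p t * sin (\<omega> * t) - p' t * cos (\<omega> * t) / \<omega>) (at t within {a..b})"
        by (simp add: has_real_derivative_iff_has_vector_derivative)
    qed
    have int': "(\<lambda>t. p' t * cos (\<omega> * t) / \<omega>) integrable_on {a..b}"
      using that by (intro integrable_continuous_interval continuous_intros contp) auto
    note by_parts = integral_unique[OF has_integral_add[OF ibp integrable_integral[OF int']]]
    have eq: "integral {a..b} (\<lambda>t. p t * sin (\<omega> * t)) =
        (- p b * cos (\<omega> * b) / \<omega> - (- p a * cos (\<omega> * a) / \<omega>))
        + integral {a..b} (\<lambda>t. p' t * cos (\<omega> * t) / \<omega>)"
      using by_parts by simp
    have "norm (integral {a..b} (\<lambda>t. p' t * cos (\<omega> * t) / \<omega>)) \<le> B / \<omega> * (b - a)"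
      using \<open>B \<ge> 0\<close> \<open>a \<le> b\<close> that
    proof (intro integral_bound)
      fix t assume "t \<in> {a..b}"
      then show "norm (p' t * cos (\<omega> * t) / \<omega>) \<le> B / \<omega>"
        using that mult_mono[OF B[of t] abs_cos_le_one[of "\<omega> * t"]] \<open>B \<ge> 0\<close>
        by (auto simp: abs_mult divide_right_mono)
    qed (auto intro!: continuous_intros contp)
    moreover have "\<bar>p c * cos (\<omega> * c) / \<omega>\<bar> \<le> \<bar>p c\<bar> / \<omega>" for c
      using that mult_left_mono[OF abs_cos_le_one[of "\<omega> * c"], of "\<bar>p c\<bar>"]
      by (auto simp: abs_mult divide_right_mono)
    note this[of a] this[of b]
    ultimately show ?thesis
      unfolding eq C_def add_divide_distrib real_norm_def times_divide_eq_left[symmetric]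
      by linarith
  qed
  have small: "\<bar>integral {a..b} (\<lambda>t. (h t - p t) * sin (\<omega> * t))\<bar> \<le> \<delta> * (b - a)" for \<omega>
    unfolding real_norm_def[symmetric] using \<open>a \<le> b\<close>
  proof (intro integral_bound)
    fix t assume "t \<in> {a..b}"
    then show "norm ((h t - p t) * sin (\<omega> * t)) \<le> \<delta>"
      using mult_mono[OF less_imp_le[OF p(2)[of t]] abs_sin_le_one[of "\<omega> * t"]] \<open>\<delta> > 0\<close>
      by (auto simp: abs_mult)
  qed (auto intro!: continuous_intros contp cont)
  have \<delta>b: "\<delta> * (b - a) < e / 2"
    using \<open>e > 0\<close> \<open>a \<le> b\<close> by (auto simp: \<delta>_def field_simps)
  have "((\<lambda>\<omega>. C / \<omega>) \<longlongrightarrow> 0) at_top" by real_asymp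
  then have "\<forall>\<^sub>F \<omega> in at_top. C / \<omega> < e / 2"
    using \<open>e > 0\<close> by (intro order_tendstoD) auto
  then show "\<forall>\<^sub>F \<omega> in at_top. dist (integral {a..b} (\<lambda>t. h t * sin (\<omega> * t))) 0 < e"
    using eventually_gt_at_top[of 0]
  proof eventually_elim
    case (elim \<omega>)
    have "integral {a..b} (\<lambda>t. h t * sin (\<omega> * t)) =
      integral {a..b} (\<lambda>t. (h t - p t) * sin (\<omega> * t)) + integral {a..b} (\<lambda>t. p t * sin (\<omega> * t))"
      by (subst integral_add[symmetric])
        (auto intro!: integrable_continuous_interval continuous_intros contp cont simp: algebra_simps)
    then show ?case using small[of \<omega>] bound_p[of \<omega>] elim \<delta>b unfolding dist_real_def by linarith
  qed
qed

text \<open>Telescoping of 2 sin A cos B = sin (B + A) - sin (B - A). The factor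
  \<open>sin (pi * t)\<close> stays on the left, so the identity also holds at the zeros of the
  sine.\<close>

lemma dirichlet_kernel:
  "sin (pi * t) * (1 + (\<Sum>m<M. 2 * cos (2 * pi * real (Suc m) * t))) = sin ((2 * real M + 1) * pi * t)"
proof (induction M)
  case (Suc M)
  define A B where "A = pi * t" and "B = 2 * pi * real (Suc M) * t"
  have AB: "(2 * real (Suc M) + 1) * pi * t = B + A" "(2 * real M + 1) * pi * t = B - A"
    by (simp_all add: A_def B_def algebra_simps)
  have "sin A * (1 + (\<Sum>m<Suc M. 2 * cos (2 * pi * real (Suc m) * t))) = sin (B - A) + 2 * (sin A * cos B)"
    using Suc.IH unfolding AB by (simp add: A_def B_def distrib_left)
  also have "\<dots> = sin (B + A)" by (simp add: sin_add sin_diff)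
  finally show ?case unfolding AB by (simp add: A_def)
qed simp

text \<open>The singularities at 0 and 1 are removable with common limit \<open>1 / pi\<close>. They
  are filled in explicitly, since division by zero would give the value 0 there and destroy
  continuity on the closed interval.\<close>

definition parabola_over_sin :: "real \<Rightarrow> real" where
  "parabola_over_sin t = (if t = 0 \<or> t = 1 then 1 / pi else t * (1 - t) / sin (pi * t))"

lemma continuous_on_parabola_over_sin: "continuous_on {0..1} parabola_over_sin"
proof -
  have ev: "\<forall>\<^sub>F t in at x. t * (1 - t) / sin (pi * t) = parabola_over_sin t" if "x \<in> {0..1}" for x
    using eventually_neq_at_within[of 0] eventually_neq_at_within[of 1]
    by eventually_elim (auto simp: parabola_over_sin_def)
  have "isCont parabola_over_sin x" if x: "x \<in> {0..1}" for x
  proof -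
    consider "x = 0" | "x = 1" | "0 < x" "x < 1" using x by fastforce
    then have "((\<lambda>t. t * (1 - t) / sin (pi * t)) \<longlongrightarrow> parabola_over_sin x) (at x)"
    proof cases
      case 1
      have "((\<lambda>t::real. t * (1 - t) / sin (pi * t)) \<longlongrightarrow> inverse pi) (at 0)" by real_asymp
      then show ?thesis using 1 by (simp add: parabola_over_sin_def inverse_eq_divide)
    next
      case 2
      \<comment> \<open>Moving the point 1 to the origin turns the sine into
        \<open>- sin (pi * t)\<close>, so this is again a limit at 0.\<close>
      have "((\<lambda>t::real. (t + 1) * (1 - (t + 1)) / sin (pi * (t + 1))) \<longlongrightarrow> inverse pi) (at 0)"
        unfolding distrib_left sin_add by simp real_asymp
      then show ?thesis using 2 LIM_offset_zero_iff[of 1 "\<lambda>t. t * (1 - t) / sin (pi * t)" "inverse pi"]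
        by (simp add: parabola_over_sin_def add.commute inverse_eq_divide)
    next
      case 3
      then have "sin (pi * x) > 0" by (intro sin_gt_zero) auto
      then show ?thesis using 3 by (auto simp: parabola_over_sin_def intro!: tendsto_eq_intros)
    qed
    then show ?thesis unfolding isCont_def using tendsto_cong[OF ev[OF x]] by blast
  qed
  then show ?thesis by (intro continuous_at_imp_continuous_on) auto
qed

section \<open>Cosine coefficients of 1/(t+x) and the trapezoid rule\<close>

text \<open>Trapezoid rule minus exact integral for the function 1/(t+x) on [0,1]; the logarithm is
  that integral.\<close>

definition trapezoid_error :: "real \<Rightarrow> real" where
  "trapezoid_error x = (1 / x + 1 / (x + 1)) / 2 - ln ((x + 1) / x)"

text \<open>The affine part interpolates 1/(t+x) at 0 and 1. The remainder shows the factor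
  \<open>t * (1 - t)\<close>, which cancels the zeros of \<open>sin (pi * t)\<close> at both
  ends.\<close>

lemma inverse_shift_eq_chord_minus_remainder:
  fixes x t :: real
  assumes "x > 0" "t \<ge> 0"
  shows "1 / (t + x) = (1 / x - 1 / (x * (x + 1)) * t) - 1 / (x * (x + 1)) * (t * (1 - t) / (t + x))"
proof -
  have nz: "x \<noteq> 0" "x + 1 \<noteq> 0" "t + x \<noteq> 0" using assms by auto
  have "1 / (t + x) = (x * (x + 1)) / (x * (x + 1) * (t + x))" using nz by simp
  also have "\<dots> = ((x + 1) * (t + x) - t * (t + x) - t * (1 - t)) / (x * (x + 1) * (t + x))"
    by (simp add: algebra_simps)
  also have "\<dots> = 1 / x - t / (x * (x + 1)) - t * (1 - t) / (x * (x + 1) * (t + x))"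
    unfolding diff_divide_distrib using nz by simp
  finally show ?thesis by simp
qed

text \<open>The chord \<open>lin\<close> is orthogonal on [0,1] to every cosine involved, so only
  \<open>- c * w\<close> contributes. The limit is then \<open>c\<close> times the integral of
  \<open>w\<close>, which is the area between chord and graph.\<close>

lemma cosine_coefficients_sums_trapezoid_error:
  assumes "x > 0"
  shows "(\<lambda>m. 2 * integral {0..1} (\<lambda>t. cos (2 * pi * real (Suc m) * t) / (t + x))) sums trapezoid_error x"
proof -
  define c where "c = 1 / (x * (x + 1))"
  define w where "w t = t * (1 - t) / (t + x)" for t
  define lin where "lin t = 1 / x - c * t" for t
  have decomp: "1 / (t + x) = lin t - c * w t" if "t \<ge> 0" for t
    using inverse_shift_eq_chord_minus_remainder[of x t] assms that by (simp add: c_def w_def lin_def mult.commute)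
  have contw: "continuous_on {0..1} w"
    unfolding w_def using assms by (intro continuous_intros) auto
  have wint: "w integrable_on {0..1}" using contw by (intro integrable_continuous_interval) 
  have cwint: "(\<lambda>t. 2 * cos (2 * pi * real (Suc m) * t) * w t) integrable_on {0..1}" for m
    by (intro integrable_continuous_interval continuous_intros contw)
  have coeff: "2 * integral {0..1} (\<lambda>t. cos (2 * pi * real (Suc m) * t) / (t + x)) =
      - c * integral {0..1} (\<lambda>t. 2 * cos (2 * pi * real (Suc m) * t) * w t)" for m
  proof -
    define k where "k = 2 * pi * real (Suc m)"
    have "k > 0" by (simp add: k_def)
    have k: "sin k = 0" "cos k = 1"
      using sin_2npi[of "Suc m"] cos_2npi[of "Suc m"] by (simp_all add: k_def mult_ac)
    \<comment> \<open>Antiderivative of \<open>cos (k * t) * lin t\<close>, found by parts. It takes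
      the same value at 0 and 1 because \<open>sin k = 0\<close> and
      \<open>cos k = 1\<close>.\<close>
    let ?F = "\<lambda>t. sin (k * t) / (k * x) - c * (t * sin (k * t) / k + cos (k * t) / k^2)"
    have "((\<lambda>t. cos (k * t) * lin t) has_integral (?F 1 - ?F 0)) {0..1}"
      using \<open>k > 0\<close> assms
      by (intro fundamental_theorem_of_calculus)
        (auto intro!: derivative_eq_intros
          simp flip: has_real_derivative_iff_has_vector_derivative
          simp: lin_def field_simps power2_eq_square)
    then have lin0: "((\<lambda>t. cos (k * t) * lin t) has_integral 0) {0..1}" using k by simp
    have dx: "cos (k * t) / (t + x) = cos (k * t) * lin t - c * (cos (k * t) * w t)" if "t \<ge> 0" for t
      using arg_cong[OF decomp[OF that], of "\<lambda>y. cos (k * t) * y"] by (simp add: algebra_simps)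
    have "((\<lambda>t. 2 * (cos (k * t) * lin t) - c * (2 * cos (k * t) * w t)) has_integral
       2 * 0 - c * integral {0..1} (\<lambda>t. 2 * cos (k * t) * w t)) {0..1}"
      using cwint[of m, folded k_def] lin0
      by (intro has_integral_diff has_integral_mult_right integrable_integral)
    then have "((\<lambda>t. 2 * (cos (k * t) / (t + x))) has_integral
       - c * integral {0..1} (\<lambda>t. 2 * cos (k * t) * w t)) {0..1}"
      by (subst (asm) has_integral_cong[where g = "\<lambda>t. 2 * (cos (k * t) / (t + x))"])
        (use dx in \<open>force simp: algebra_simps\<close>)+
    then show ?thesis unfolding k_def[symmetric] integral_mult_right[symmetric] by (rule integral_unique)
  qed
  \<comment> \<open>The cosine sum lacks the constant term 1 of the Dirichlet kernel; adding and
    subtracting it produces the main term \<open>c * integral {0..1} w\<close>.\<close>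
  have partial: "(\<Sum>m<M. 2 * integral {0..1} (\<lambda>t. cos (2 * pi * real (Suc m) * t) / (t + x))) =
      c * integral {0..1} w
      - c * integral {0..1} (\<lambda>t. parabola_over_sin t / (t + x) * sin ((2 * real M + 1) * pi * t))" for M
  proof -
    have kernel: "w t * (1 + (\<Sum>m<M. 2 * cos (2 * pi * real (Suc m) * t))) =
        parabola_over_sin t / (t + x) * sin ((2 * real M + 1) * pi * t)" if "t \<in> {0..1}" for t
    \<comment> \<open>At the endpoints both sides vanish: \<open>w\<close> by its factor
      \<open>t * (1 - t)\<close>, the right side because the sine is taken at a multiple of
      \<open>pi\<close>.\<close>
    proof (cases "t = 0 \<or> t = 1")
      case True
      have "sin ((2 * real M + 1) * pi) = 0"
        using sin_npi[of "2 * M + 1"] by (simp add: mult.commute add.commute)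
      then show ?thesis using True by (auto simp: w_def)
    next
      case False
      then have "sin (pi * t) > 0" using that by (intro sin_gt_zero) auto
      then have "w t = parabola_over_sin t / (t + x) * sin (pi * t)"
        using False by (simp add: w_def parabola_over_sin_def)
      then show ?thesis using dirichlet_kernel[of t M] by simp
    qed
    have "(\<Sum>m<M. integral {0..1} (\<lambda>t. 2 * cos (2 * pi * real (Suc m) * t) * w t)) + integral {0..1} w
       = integral {0..1} (\<lambda>t. (\<Sum>m<M. 2 * cos (2 * pi * real (Suc m) * t) * w t) + w t)"
      using cwint wint by (subst integral_add) (auto intro!: integrable_sum simp: integral_sum)
    also have "\<dots> = integral {0..1} (\<lambda>t. parabola_over_sin t / (t + x) * sin ((2 * real M + 1) * pi * t))"
      by (intro integral_cong, subst kernel[symmetric])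
        (auto simp: algebra_simps sum_distrib_left)
    finally show ?thesis
      unfolding coeff sum_distrib_left[symmetric] by (metis (no_types, lifting) add_diff_cancel_left' add_diff_cancel_right' minus_diff_eq mult_minus_left right_diff_distrib)
  qed
  have "(\<lambda>M. integral {0..1} (\<lambda>t. parabola_over_sin t / (t + x) * sin ((2 * real M + 1) * pi * t))) \<longlonglongrightarrow> 0"
  proof (rule filterlim_compose[OF riemann_lebesgue_sin])
    show "continuous_on {0..1} (\<lambda>t. parabola_over_sin t / (t + x))"
      using assms by (intro continuous_intros continuous_on_parabola_over_sin) auto
    show "filterlim (\<lambda>M. (2 * real M + 1) * pi) at_top sequentially" by real_asymp
  qed auto
  then have "(\<lambda>m. 2 * integral {0..1} (\<lambda>t. cos (2 * pi * real (Suc m) * t) / (t + x))) sums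
      (c * integral {0..1} w)"
    unfolding sums_def partial by (auto intro!: tendsto_eq_intros)
  \<comment> \<open>\<open>c * w\<close> is the chord minus 1/(t+x), and the chord integrates to the
    mean of the two end values.\<close>
  moreover have "c * integral {0..1} w = trapezoid_error x"
  proof -
    let ?F = "\<lambda>t. t / x - c * t^2 / 2 - ln (t + x)"
    have "((\<lambda>t. c * w t) has_integral (?F 1 - ?F 0)) {0..1}"
    proof (intro fundamental_theorem_of_calculus)
      fix t :: real assume t: "t \<in> {0..1}"
      have "(?F has_real_derivative (lin t - 1 / (t + x))) (at t within {0..1})"
        using t assms unfolding lin_def by (auto intro!: derivative_eq_intros)
      moreover have "lin t - 1 / (t + x) = c * w t" using decomp[of t] t by simp
      ultimately show "(?F has_vector_derivative c * w t) (at t within {0..1})"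
        by (simp add: has_real_derivative_iff_has_vector_derivative)
    qed auto
    then have "c * integral {0..1} w = ?F 1 - ?F 0" by (simp add: integral_unique flip: integral_mult_right)
    also have "\<dots> = trapezoid_error x"
    proof -
      have "1 / x - 1 / (x * (x + 1)) / 2 = (1 / x + 1 / (x + 1)) / 2"
        using assms by (simp add: divide_simps)
      then show ?thesis
        using assms by (simp add: trapezoid_error_def c_def ln_div add.commute)
    qed
    finally show ?thesis .
  qed
  ultimately show ?thesis by simp
qed

section \<open>Convergence and decay of the integral of cos t/(t+z)\<close>

lemma tendsto_at_top_mono_bounded:
  fixes f :: "real \<Rightarrow> real"
  assumes mono: "\<And>x y. c \<le> x \<Longrightarrow> x \<le> y \<Longrightarrow> f x \<le> f y"
    and bound: "\<And>x. c \<le> x \<Longrightarrow> f x \<le> B"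
  obtains L where "(f \<longlongrightarrow> L) at_top"
proof
  have bdd: "bdd_above (f ` {c..})" using bound by (auto simp: bdd_above_def)
  show "(f \<longlongrightarrow> (SUP x\<in>{c..}. f x)) at_top"
  proof (rule order_tendstoI)
    fix y assume "y < (SUP x\<in>{c..}. f x)"
    then obtain x where "x \<ge> c" "y < f x" using less_cSUP_iff[OF _ bdd] by auto
    have "\<forall>\<^sub>F z in at_top. f x \<le> f z"
      using eventually_ge_at_top[of x] by eventually_elim (rule mono[OF \<open>x \<ge> c\<close>])
    then show "\<forall>\<^sub>F z in at_top. y < f z"
      using \<open>y < f x\<close> by (auto elim: eventually_mono)
  next
    fix y assume y: "(SUP x\<in>{c..}. f x) < y"
    show "\<forall>\<^sub>F z in at_top. f z < y"
      using eventually_ge_at_top[of c]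
      by eventually_elim (use cSUP_upper[OF _ bdd] y in \<open>auto intro: le_less_trans\<close>)
  qed
qed

lemma integral_inverse_cube:
  fixes z R :: real
  assumes "z > 0" "R \<ge> 0"
  shows "((\<lambda>t. 1 / (t + z)^3) has_integral (1 / (2 * z^2) - 1 / (2 * (R + z)^2))) {0..R}"
proof -
  have "((\<lambda>t. 1 / (t + z)^3) has_integral (- 1 / (2 * (R + z)^2) - (- 1 / (2 * (0 + z)^2)))) {0..R}"
  proof (rule fundamental_theorem_of_calculus[OF \<open>R \<ge> 0\<close>])
    fix t assume "t \<in> {0..R}"
    then have "t + z > 0" using assms by auto
    then have "((\<lambda>t. - 1 / (2 * (t + z)^2)) has_real_derivative 1 / (t + z)^3) (at t within {0..R})"
      by (auto intro!: derivative_eq_intros simp: divide_simps power2_eq_square power3_eq_cube)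
    then show "((\<lambda>t. - 1 / (2 * (t + z)^2)) has_vector_derivative 1 / (t + z)^3) (at t within {0..R})"
      by (simp add: has_real_derivative_iff_has_vector_derivative)
  qed
  then show ?thesis by simp
qed

text \<open>Two integrations by parts merged into one antiderivative: the terms with sin t/(t+z)^2
  cancel. A conditionally convergent integral is traded for an absolutely convergent one.\<close>

lemma integral_cos_over_shift_by_parts:
  fixes z R :: real
  assumes "z > 0" "R \<ge> 0"
  shows "integral {0..R} (\<lambda>t. cos t / (t + z)) =
    sin R / (R + z) - cos R / (R + z)^2 + 1 / z^2 - 2 * integral {0..R} (\<lambda>t. cos t / (t + z)^3)"
proof -
  let ?F = "\<lambda>t. sin t / (t + z) - cos t / (t + z)^2"
  have ibp: "((\<lambda>t. cos t / (t + z) + 2 * (cos t / (t + z)^3)) has_integral (?F R - ?F 0)) {0..R}"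
  proof (rule fundamental_theorem_of_calculus[OF \<open>R \<ge> 0\<close>])
    fix t assume "t \<in> {0..R}"
    then have pos: "t + z > 0" using assms by auto
    \<comment> \<open>Written with \<open>inverse\<close>, the derivative is a polynomial in
      \<open>inverse (t + z)\<close>, so ring normalization settles it.\<close>
    have "((\<lambda>t. sin t * inverse (t + z) - cos t * (inverse (t + z))^2) has_real_derivative
        cos t * inverse (t + z) + 2 * (cos t * (inverse (t + z))^3)) (at t within {0..R})"
      using pos by (auto intro!: derivative_eq_intros simp: power2_eq_square power3_eq_cube algebra_simps)
    then show "(?F has_vector_derivative cos t / (t + z) + 2 * (cos t / (t + z)^3)) (at t within {0..R})"
      by (simp add: has_real_derivative_iff_has_vector_derivative divide_inverse power_inverse)
  qed
  have int: "(\<lambda>t. cos t / (t + z)^3) integrable_on {0..R}"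
    using assms by (intro integrable_continuous_interval continuous_intros) auto
  have "((\<lambda>t. cos t / (t + z)) has_integral
      (?F R - ?F 0) - 2 * integral {0..R} (\<lambda>t. cos t / (t + z)^3)) {0..R}"
    using has_integral_diff[OF ibp has_integral_mult_right[OF integrable_integral[OF int], of 2]] by simp
  then show ?thesis by (simp add: integral_unique)
qed

text \<open>By parts the limit is \<open>1 / z^2 - 2 * l\<close> with \<open>l\<close> at most
  \<open>1 / (2 * z^2)\<close> in absolute value, which gives the bound. This quadratic decay drives
  the absolute convergence of the series below.\<close>

lemma integral_cos_over_shift_tendsto:
  fixes z :: real
  assumes "z > 0"
  obtains L where "((\<lambda>R. integral {0..R} (\<lambda>t. cos t / (t + z))) \<longlongrightarrow> L) at_top" "\<bar>L\<bar> \<le> 2 / z^2"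
proof -
  have cubeint: "(\<lambda>t. 1 / (t + z)^3) integrable_on {a..b}" 
    and cosint: "(\<lambda>t. cos t / (t + z)^3) integrable_on {a..b}" if "a \<ge> 0" for a b
    using assms that by (auto intro!: integrable_continuous_interval continuous_intros)
  have cube: "integral {0..R} (\<lambda>t. 1 / (t + z)^3) = 1 / (2 * z^2) - 1 / (2 * (R + z)^2)" if "R \<ge> 0" for R
    using integral_inverse_cube[OF assms that] by (rule integral_unique)
  have cube_le: "integral {0..R} (\<lambda>t. 1 / (t + z)^3) \<le> 1 / (2 * z^2)" if "R \<ge> 0" for R
    unfolding cube[OF that] by simp
  have cos_le: "\<bar>integral {0..R} (\<lambda>t. cos t / (t + z)^3)\<bar> \<le> 1 / (2 * z^2)" if "R \<ge> 0" for R
  proof -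
    have "norm (integral {0..R} (\<lambda>t. cos t / (t + z)^3)) \<le> integral {0..R} (\<lambda>t. 1 / (t + z)^3)"
      using assms by (intro integral_norm_bound_integral cubeint cosint)
        (auto simp: abs_mult abs_divide intro!: divide_right_mono)
    then show ?thesis using cube_le[OF that] by simp
  qed
  \<comment> \<open>Adding \<open>1 / (t + z)^3\<close> makes the integrand nonnegative, so
    \<open>P\<close> is monotone and bounded, hence convergent; the known limit of the added part is
    subtracted afterwards.\<close>
  define P where "P R = integral {0..R} (\<lambda>t. 1 / (t + z)^3 + cos t / (t + z)^3)" for R
  have P: "P R = integral {0..R} (\<lambda>t. 1 / (t + z)^3) + integral {0..R} (\<lambda>t. cos t / (t + z)^3)" for R
    unfolding P_def by (intro integral_add cubeint cosint) auto
  obtain p where p: "(P \<longlongrightarrow> p) at_top"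
  proof (rule tendsto_at_top_mono_bounded[of 0 P "1 / z^2"])
    fix x y :: real assume xy: "0 \<le> x" "x \<le> y"
    have nonneg: "1 / (t + z)^3 + cos t / (t + z)^3 \<ge> 0" if "t \<ge> 0" for t
      unfolding add_divide_distrib[symmetric]
    proof (rule divide_nonneg_pos)
      show "0 \<le> 1 + cos t" using cos_ge_minus_one[of t] by linarith
    qed (use that assms in auto)
    show "P x \<le> P y"
      unfolding P_def using xy nonneg
      by (intro integral_subset_le integrable_add cubeint cosint) auto
  next
    fix x :: real assume "0 \<le> x"
    then show "P x \<le> 1 / z^2" unfolding P using cube_le[of x] cos_le[of x] by simp
  qed
  define l where "l = p - 1 / (2 * z^2)"
  have "((\<lambda>R. P R - (1 / (2 * z^2) - 1 / (2 * (R + z)^2))) \<longlongrightarrow> p - (1 / (2 * z^2) - 0)) at_top"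
    by (intro tendsto_intros p) real_asymp
  moreover have "\<forall>\<^sub>F R in at_top. P R - (1 / (2 * z^2) - 1 / (2 * (R + z)^2)) =
      integral {0..R} (\<lambda>t. cos t / (t + z)^3)"
    using eventually_ge_at_top[of 0] by eventually_elim (simp add: P cube)
  ultimately have l: "((\<lambda>R. integral {0..R} (\<lambda>t. cos t / (t + z)^3)) \<longlongrightarrow> l) at_top"
    unfolding l_def by (simp add: tendsto_cong)
  have "\<bar>l\<bar> \<le> 1 / (2 * z^2)"
    by (rule tendsto_upperbound[OF tendsto_rabs[OF l]])
      (auto intro: eventually_mono[OF eventually_ge_at_top[of 0] cos_le])
  have "((\<lambda>R. sin R / (R + z) - cos R / (R + z)^2 + 1 / z^2 - 2 * integral {0..R} (\<lambda>t. cos t / (t + z)^3))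
      \<longlongrightarrow> 0 - 0 + 1 / z^2 - 2 * l) at_top"
  proof (intro tendsto_intros l)
    show "((\<lambda>R. sin R / (R + z)) \<longlongrightarrow> 0) at_top" by real_asymp
    show "((\<lambda>R. cos R / (R + z)^2) \<longlongrightarrow> 0) at_top" by real_asymp
  qed
  moreover have "\<forall>\<^sub>F R in at_top.
      sin R / (R + z) - cos R / (R + z)^2 + 1 / z^2 - 2 * integral {0..R} (\<lambda>t. cos t / (t + z)^3) =
      integral {0..R} (\<lambda>t. cos t / (t + z))"
    using eventually_ge_at_top[of 0]
    by eventually_elim (simp add: integral_cos_over_shift_by_parts assms)
  ultimately have lim: "((\<lambda>R. integral {0..R} (\<lambda>t. cos t / (t + z))) \<longlongrightarrow> 1 / z^2 - 2 * l) at_top"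
    by (simp add: tendsto_cong)
  have "\<bar>1 / z^2 - 2 * l\<bar> \<le> 2 / z^2" using \<open>\<bar>l\<bar> \<le> _\<close> unfolding abs_le_iff by (simp add: field_simps)
  then show ?thesis using lim that by blast
qed

text \<open>The function g of the outline. Its value is meaningful once the limit is known to exist,
  which is shown for positive \<open>z\<close>.\<close>

definition cos_shift_integral :: "real \<Rightarrow> real" where
  "cos_shift_integral z = improper_integral (\<lambda>t. cos t / (t + z))"

lemma cos_shift_integral:
  assumes "z > 0"
  shows cos_shift_integral_tendsto:
      "((\<lambda>R. integral {0..R} (\<lambda>t. cos t / (t + z))) \<longlongrightarrow> cos_shift_integral z) at_top"
    and abs_cos_shift_integral_le: "\<bar>cos_shift_integral z\<bar> \<le> 2 / z^2"
    and improper_integral_converges_cos_shift: "improper_integral_converges (\<lambda>t. cos t / (t + z))"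
proof -
  obtain L where L: "((\<lambda>R. integral {0..R} (\<lambda>t. cos t / (t + z))) \<longlongrightarrow> L) at_top" "\<bar>L\<bar> \<le> 2 / z^2"
    using integral_cos_over_shift_tendsto[OF assms] .
  have eq: "cos_shift_integral z = L"
    unfolding cos_shift_integral_def improper_integral_def using tendsto_Lim[OF _ L(1)] by simp
  show "((\<lambda>R. integral {0..R} (\<lambda>t. cos t / (t + z))) \<longlongrightarrow> cos_shift_integral z) at_top"
    and "\<bar>cos_shift_integral z\<bar> \<le> 2 / z^2"
    using L eq by auto
  show "improper_integral_converges (\<lambda>t. cos t / (t + z))"
    unfolding improper_integral_converges_def using assms L(1)
    by (auto intro!: integrable_continuous_interval continuous_intros)
qed

section \<open>Scaling and periodicity\<close>

text \<open>Substitution t = k s, with the factor \<open>k\<close> absorbed by the denominator.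
  Integer upper limits prepare for shifts by the period 1.\<close>

lemma scaled_cos_integral_tendsto:
  assumes "k > 0" "x > 0"
  shows "(\<lambda>K. integral {0..real K} (\<lambda>s. cos (k * s) / (s + x))) \<longlonglongrightarrow> cos_shift_integral (k * x)"
proof -
  have "integral {0..real K} (\<lambda>s. cos (k * s) / (s + x)) =
      integral {0..k * real K} (\<lambda>t. cos t / (t + k * x))" for K
  proof -
    have "((\<lambda>s. k *\<^sub>R (cos (k * s) / (k * s + k * x))) has_integral
        integral {k * 0..k * real K} (\<lambda>t. cos t / (t + k * x))) {0..real K}"
    proof (rule has_integral_substitution)
      show "continuous_on {0..k * real K} (\<lambda>t. cos t / (t + k * x))"
        using assms by (intro continuous_intros) (auto simp: add_nonneg_eq_0_iff)
    qed (use assms in \<open>auto intro!: derivative_eq_intros mult_left_mono\<close>)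
    moreover have "k *\<^sub>R (cos (k * s) / (k * s + k * x)) = cos (k * s) / (s + x)" for s
      using assms by (simp flip: distrib_left)
    ultimately show ?thesis by (simp add: integral_unique)
  qed
  moreover have "filterlim (\<lambda>K. k * real K) at_top sequentially" using assms by real_asymp
  ultimately show ?thesis
    using filterlim_compose[OF cos_shift_integral_tendsto[of "k * x"]] assms by simp
qed

text \<open>The cosine has period 1 in \<open>s\<close>, so passing from \<open>x\<close> to
  \<open>x + 1\<close> only moves the interval of integration by one unit.\<close>

lemma cos_shift_integral_diff:
  assumes "x > 0" "m > 0"
  shows "cos_shift_integral (2 * pi * real m * x) - cos_shift_integral (2 * pi * real m * (x + 1)) =
    integral {0..1} (\<lambda>t. cos (2 * pi * real m * t) / (t + x))"
proof -
  define k where "k = 2 * pi * real m"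
  have "k > 0" using assms by (simp add: k_def)
  let ?A = "\<lambda>x K. integral {0..real K} (\<lambda>s. cos (k * s) / (s + x))"
  have periodic: "cos (k * (s + 1)) = cos (k * s)" for s
    using sin_2npi[of m] cos_2npi[of m] by (simp add: k_def distrib_left cos_add mult_ac)
  have int: "(\<lambda>s. cos (k * s) / (s + x)) integrable_on {a..b}" if "a \<ge> 0" for a b
    using assms that by (auto intro!: integrable_continuous_interval continuous_intros)
  \<comment> \<open>With upper limits \<open>Suc K\<close> and \<open>K\<close> the overlap on
    [1,K+1] cancels exactly, and the difference is constant in \<open>K\<close>.\<close>
  have "?A x (Suc K) - ?A (x + 1) K = integral {0..1} (\<lambda>t. cos (k * t) / (t + x))" for K
  proof -
    have "((\<lambda>s. 1 *\<^sub>R (cos (k * (s + 1)) / (s + 1 + x))) has_integral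
        integral {0 + 1..real K + 1} (\<lambda>s. cos (k * s) / (s + x))) {0..real K}"
    proof (rule has_integral_substitution)
      show "continuous_on {1..real K + 1} (\<lambda>s. cos (k * s) / (s + x))"
        using assms by (intro continuous_intros) auto
    qed (auto intro!: derivative_eq_intros)
    then have "?A (x + 1) K = integral {1..real (Suc K)} (\<lambda>s. cos (k * s) / (s + x))"
      by (simp add: periodic add_ac integral_unique)
    then show ?thesis
      using Henstock_Kurzweil_Integration.integral_combine[of 0 1 "real (Suc K)" "\<lambda>s. cos (k * s) / (s + x)"] int
      by simp
  qed
  moreover have "(\<lambda>K. ?A x (Suc K) - ?A (x + 1) K) \<longlonglongrightarrow>
      cos_shift_integral (k * x) - cos_shift_integral (k * (x + 1))"
    using assms \<open>k > 0\<close>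
    by (intro tendsto_diff LIMSEQ_Suc scaled_cos_integral_tendsto) auto
  ultimately show ?thesis unfolding k_def by (simp add: LIMSEQ_const_iff)
qed

section \<open>The cosine-integral series for the digamma function\<close>

text \<open>The bound 2/z^2 at z = 2 pi m x is 1/(2 pi^2 x^2 m^2); summing 1/m^2 to pi^2/6 leaves
  1/(12 x^2).\<close>

lemma cos_shift_series_summable:
  assumes "x > 0"
  shows "summable (\<lambda>m. cos_shift_integral (2 * pi * real (Suc m) * x))"
    and "\<bar>\<Sum>m. cos_shift_integral (2 * pi * real (Suc m) * x)\<bar> \<le> 1 / (12 * x^2)"
proof -
  let ?b = "\<lambda>m. 1 / (2 * pi^2 * x^2) * (1 / (real (m + 1))^2)"
  have le: "norm (cos_shift_integral (2 * pi * real (Suc m) * x)) \<le> ?b m" for m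
  proof -
    have "2 / (2 * pi * real (Suc m) * x)^2 = ?b m"
      by (simp add: power_mult_distrib del: of_nat_Suc)
    then show ?thesis using abs_cos_shift_integral_le[of "2 * pi * real (Suc m) * x"] assms by simp
  qed
  have sums: "?b sums (1 / (2 * pi^2 * x^2) * (pi^2 / 6))"
    using sums_mult[OF inverse_squares_sums, of "1 / (2 * pi^2 * x^2)"] by (simp add: add.commute)
  show "summable (\<lambda>m. cos_shift_integral (2 * pi * real (Suc m) * x))"
    by (rule summable_comparison_test'[OF sums_summable[OF sums] le])
  show "\<bar>\<Sum>m. cos_shift_integral (2 * pi * real (Suc m) * x)\<bar> \<le> 1 / (12 * x^2)"
    using norm_suminf_le[OF le sums_summable[OF sums]] sums_unique[OF sums] by simp
qed

text \<open>The difference equation fixes \<open>F\<close> only up to a function of period 1; the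
  decay of \<open>F\<close> along x + n removes this freedom.\<close>

lemma log_minus_digamma_eq_cos_shift_series:
  assumes "x > 0"
  shows "ln x - 1 / (2 * x) - Digamma x = 2 * (\<Sum>m. cos_shift_integral (2 * pi * real (Suc m) * x))"
proof -
  define F where "F x = 2 * (\<Sum>m. cos_shift_integral (2 * pi * real (Suc m) * x))" for x
  have step: "F y - F (y + 1) = trapezoid_error y" if "y > 0" for y
  proof -
    have "(\<lambda>m. 2 * cos_shift_integral (2 * pi * real (Suc m) * y)
        - 2 * cos_shift_integral (2 * pi * real (Suc m) * (y + 1))) sums (F y - F (y + 1))"
      unfolding F_def using that
      by (intro sums_diff sums_mult summable_sums cos_shift_series_summable) auto
    then show ?thesis
      using cosine_coefficients_sums_trapezoid_error[OF that] that
      by (simp only: right_diff_distrib[symmetric] cos_shift_integral_diff zero_less_Suc) (rule sums_unique2)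
  qed
  have F_sum: "(\<Sum>k<n. trapezoid_error (x + real k)) = F x - F (x + real n)" for n
    using assms by (induction n) (simp_all add: add_ac flip: step)
  \<comment> \<open>The logarithms telescope, and the halves of neighbouring reciprocals combine to
    full ones, up to a correction at the two ends.\<close>
  have T_sum: "(\<Sum>k<n. trapezoid_error (x + real k)) =
      (\<Sum>k<n. inverse (x + real k)) + (1 / (x + real n) - 1 / x) / 2 - ln (x + real n) + ln x" for n
  proof (induction n)
    case (Suc n)
    have "trapezoid_error (x + real n) =
        (inverse (x + real n) + inverse (x + real (Suc n))) / 2 - (ln (x + real (Suc n)) - ln (x + real n))"
    proof -
      have "x + real (Suc n) = (x + real n) + 1" by simp
      then show ?thesis
        using assms unfolding trapezoid_error_def by (simp only:) (subst ln_div, auto simp: inverse_eq_divide)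
    qed
    \<comment> \<open>The induction step is linear in its atoms, so it is proved for arbitrary reals
      standing for them.\<close>
    moreover have "S + T = I + A + (B - c) / 2 - L' + l"
      if "T = (A + B) / 2 - (L' - L)" "S = I + (A - c) / 2 - L + l" for S T I A B L L' l c :: real
      using that by (simp add: field_simps)
    ultimately show ?case using Suc unfolding sum.lessThan_Suc inverse_eq_divide by blast
  qed simp
  have "(\<lambda>n. F (x + real n)) \<longlonglongrightarrow> 0"
  proof (rule tendsto_0_le)
    show "(\<lambda>n. 1 / (x + real n)^2) \<longlonglongrightarrow> 0" by real_asymp
    show "\<forall>\<^sub>F n in sequentially. norm (F (x + real n)) \<le> norm (1 / (x + real n)^2) * (1 / 6)"
    proof (intro always_eventually allI)
      fix n
      show "norm (F (x + real n)) \<le> norm (1 / (x + real n)^2) * (1 / 6)"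
        using cos_shift_series_summable(2)[of "x + real n"] assms
        by (simp add: F_def abs_mult add_pos_nonneg)
    qed
  qed
  then have "(\<lambda>n. F x - F (x + real n)) \<longlonglongrightarrow> F x" by (auto intro!: tendsto_eq_intros)
  \<comment> \<open>Second evaluation of the same limit: \<open>ln (real n)\<close> is inserted to
    match the limit formula for \<open>Digamma\<close>.\<close>
  moreover have "(\<lambda>n. F x - F (x + real n)) \<longlonglongrightarrow> - Digamma x + (0 - 1 / x) / 2 - 0 + ln x"
  proof -
    have "(\<lambda>n. 1 / (x + real n)) \<longlonglongrightarrow> 0" by real_asymp
    moreover have "(\<lambda>n. ln (x + real n) - ln (real n)) \<longlonglongrightarrow> 0" by real_asymp
    moreover have "(\<lambda>n. ln (real n) - (\<Sum>k<n. inverse (x + real k))) \<longlonglongrightarrow> Digamma x"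
      using Digamma_LIMSEQ[of x] assms by simp
    ultimately have "(\<lambda>n. - (ln (real n) - (\<Sum>k<n. inverse (x + real k)))
        + (1 / (x + real n) - 1 / x) / 2 - (ln (x + real n) - ln (real n)) + ln x) \<longlonglongrightarrow>
        - Digamma x + (0 - 1 / x) / 2 - 0 + ln x"
      by (intro tendsto_intros) auto
    then show ?thesis unfolding F_sum[symmetric] T_sum by (simp add: algebra_simps)
  qed
  ultimately have "F x = - Digamma x + (0 - 1 / x) / 2 - 0 + ln x" by (rule LIMSEQ_unique)
  then show ?thesis by (simp add: F_def)
qed

section \<open>Regrouping a double series by products\<close>

text \<open>Indices start at 0: (n, m) stands for the factors n+1 and m+1. Hence the product is
  stored as its predecessor, while the divisor is stored as it is.\<close>

lemma bij_betw_pairs_divisors: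
  "bij_betw (\<lambda>(n, m). (Suc m * Suc n - 1, Suc n)) (UNIV \<times> UNIV) (SIGMA N:UNIV. {d. d dvd Suc N})"
proof (rule bij_betw_imageI)
  show "inj_on (\<lambda>(n, m). (Suc m * Suc n - 1, Suc n)) (UNIV \<times> UNIV)"
  proof (rule inj_onI, clarsimp simp del: mult_Suc mult_Suc_right)
    fix n m m' assume "Suc m * Suc n - Suc 0 = Suc m' * Suc n - Suc 0"
    then have "Suc m * Suc n = Suc m' * Suc n" by simp
    then show "m = m'" by (simp only: mult_cancel2) simp
  qed
  have "(N, d) \<in> (\<lambda>(n, m). (Suc m * Suc n - 1, Suc n)) ` (UNIV \<times> UNIV)" if "d dvd Suc N" for N d
  proof -
    obtain k where k: "Suc N = d * k" using \<open>d dvd Suc N\<close> ..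
    then have "0 < d * k" by (metis zero_less_Suc)
    then obtain n m where "d = Suc n" "k = Suc m"
      by (cases d; cases k) auto
    moreover from this k have "N = Suc m * Suc n - 1" by (simp add: mult.commute)
    ultimately show ?thesis by (intro image_eqI[of _ _ "(n, m)"]) auto
  qed
  moreover have "Suc n dvd Suc (Suc m * Suc n - 1)" for n m
    by (metis Suc_pred' dvd_triv_right mult_pos_pos zero_less_Suc)
  ultimately show "(\<lambda>(n, m). (Suc m * Suc n - 1, Suc n)) ` (UNIV \<times> UNIV) = (SIGMA N:UNIV. {d. d dvd Suc N})"
    by (auto simp del: mult_Suc mult_Suc_right)
qed

text \<open>The family is dominated by C/(m^2 n^2), hence absolutely summable, and may be summed by
  rows or by the value N of the product. Over a fixed N the terms are constant, one for each
  divisor.\<close>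

lemma double_series_eq_divisor_series:
  fixes h :: "nat \<Rightarrow> real"
  assumes bound: "\<And>n. n > 0 \<Longrightarrow> \<bar>h n\<bar> \<le> C / (real n)^2"
  shows "summable (\<lambda>n. \<Sum>m. h (Suc m * Suc n))"
    and "summable (\<lambda>n. real (divisor_count (Suc n)) * h (Suc n))"
    and "(\<Sum>n. \<Sum>m. h (Suc m * Suc n)) = (\<Sum>n. real (divisor_count (Suc n)) * h (Suc n))"
proof -
  let ?D = "SIGMA N:UNIV. {d. d dvd Suc N}"
  define f where "f = (\<lambda>(n, m). h (Suc m * Suc n))"
  have inv2: "(\<lambda>n. 1 / (real (Suc n))^2) summable_on UNIV"
    using inverse_squares_sums sums_summable by (intro norm_summable_imp_summable_on) (auto simp: sums_iff)
  have "C \<ge> 0" using bound[of 1] by (simp add: order_trans[OF abs_ge_zero])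
  have "(\<lambda>p. norm (f p)) summable_on UNIV \<times> UNIV"
  proof (rule Infinite_Sum.abs_summable_on_comparison_test')
    let ?g = "\<lambda>n. 1 / (real (Suc n))^2"
    show "(\<lambda>(n, m). C * (?g n * ?g m)) summable_on UNIV \<times> UNIV"
    proof (rule summable_on_SigmaI)
      show "((\<lambda>m. case (n, m) of (n, m) \<Rightarrow> C * (?g n * ?g m)) has_sum C * (?g n * infsum ?g UNIV)) UNIV" for n
        using has_sum_cmult_right[OF has_sum_cmult_right[OF has_sum_infsum[OF inv2]], of C "?g n"] by simp
      show "(\<lambda>n. C * (?g n * infsum ?g UNIV)) summable_on UNIV"
        by (intro summable_on_cmult_right summable_on_cmult_left inv2)
    qed (use \<open>C \<ge> 0\<close> in auto)
    show "norm (f p) \<le> (case p of (n, m) \<Rightarrow> C * (?g n * ?g m))" for p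
    proof (cases p)
      case (Pair n m)
      have "\<bar>h (Suc m * Suc n)\<bar> \<le> C / (real (Suc m) * real (Suc n))^2"
        using bound[of "Suc m * Suc n"] unfolding of_nat_mult by simp
      then show ?thesis
        unfolding f_def Pair by (simp add: power_mult_distrib mult.commute del: mult_Suc mult_Suc_right of_nat_Suc)
    qed
  qed
  then have "f summable_on UNIV \<times> UNIV" by (rule abs_summable_summable)
  then obtain s where s: "(f has_sum s) (UNIV \<times> UNIV)" by (auto simp: summable_on_def)
  have row: "((\<lambda>m. f (n, m)) has_sum (\<Sum>m. h (Suc m * Suc n))) UNIV" for n
  proof -
    have "(\<lambda>m. f (n, m)) summable_on UNIV"
      using summable_on_SigmaD1[of "\<lambda>n m. f (n, m)" UNIV "\<lambda>_. UNIV" n] s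
      by (auto simp: has_sum_imp_summable)
    then have sum: "((\<lambda>m. f (n, m)) has_sum infsum (\<lambda>m. f (n, m)) UNIV) UNIV" by simp
    then show ?thesis using has_sum_imp_sums[OF sum] by (simp add: sums_iff f_def)
  qed
  have rows: "(\<lambda>n. \<Sum>m. h (Suc m * Suc n)) sums s"
    using has_sum_imp_sums[OF has_sum_SigmaD[OF s row]] .
  have "((\<lambda>(N, d). h (Suc N)) has_sum s) ?D"
  proof -
    have "((\<lambda>(N, d). h (Suc N)) has_sum s) ?D \<longleftrightarrow> (f has_sum s) (UNIV \<times> UNIV)"
      using has_sum_reindex_bij_betw[OF bij_betw_pairs_divisors, of "\<lambda>(N, d). h (Suc N)"]
      by (simp add: f_def case_prod_unfold)
    then show ?thesis using s by simp
  qed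
  moreover have "((\<lambda>d. h (Suc N)) has_sum (real (divisor_count (Suc N)) * h (Suc N))) {d. d dvd Suc N}" for N
    using has_sum_finite[of "{d. d dvd Suc N}" "\<lambda>d. h (Suc N)"] by (simp add: divisor_count_def)
  ultimately have "((\<lambda>N. real (divisor_count (Suc N)) * h (Suc N)) has_sum s) UNIV"
    using has_sum_SigmaD[where f = "\<lambda>(N, d). h (Suc N)" and B = "\<lambda>N. {d. d dvd Suc N}"] by simp
  then have cols: "(\<lambda>N. real (divisor_count (Suc N)) * h (Suc N)) sums s" by (rule has_sum_imp_sums)
  show "summable (\<lambda>n. \<Sum>m. h (Suc m * Suc n))"
    and "summable (\<lambda>n. real (divisor_count (Suc n)) * h (Suc n))"
    and "(\<Sum>n. \<Sum>m. h (Suc m * Suc n)) = (\<Sum>n. real (divisor_count (Suc n)) * h (Suc n))"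
    using rows cols by (auto simp: sums_iff)
qed

section \<open>Specialization to x = n/a\<close>

theorem mainTheorem5:
  fixes a :: real
  assumes "a > 0"
  shows "summable (\<lambda>n. S_term a (Suc n)) \<and>
    (\<forall>n\<ge>1. improper_integral_converges (cos_integrand a n)) \<and>
    summable (\<lambda>n. real (divisor_count (Suc n)) * improper_integral (cos_integrand a (Suc n))) \<and>
    S a = 2 * (\<Sum>n. real (divisor_count (Suc n)) * improper_integral (cos_integrand a (Suc n)))"
proof -
  define h where "h n = improper_integral (cos_integrand a n)" for n
  have integrand: "cos_integrand a n = (\<lambda>t. cos t / (t + 2 * real n * pi / a))" for n
    by (simp add: cos_integrand_def fun_eq_iff)
  have h: "h n = cos_shift_integral (2 * real n * pi / a)" for n
    by (simp add: h_def cos_shift_integral_def integrand)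
  \<comment> \<open>The constant is 2/z^2 at z = 2 n pi/a.\<close>
  have "\<bar>h n\<bar> \<le> (a^2 / (2 * pi^2)) / (real n)^2" if "n > 0" for n
    using abs_cos_shift_integral_le[of "2 * real n * pi / a"] assms that
    by (simp add: h power_mult_distrib power_divide mult_ac)
  note double = double_series_eq_divisor_series[OF this]
  have "S_term a (Suc n) = 2 * (\<Sum>m. h (Suc m * Suc n))" for n
  proof -
    \<comment> \<open>At x = (n+1)/a the argument 2 pi (m+1) x depends only on the product
      (m+1)(n+1), which lets the terms be collected by divisors.\<close>
    have "2 * pi * real (Suc m) * (real (Suc n) / a) = 2 * real (Suc m * Suc n) * pi / a" for m
      unfolding of_nat_mult by simp
    then show ?thesis
      unfolding h S_term_def using log_minus_digamma_eq_cos_shift_series[of "real (Suc n) / a"] assms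
      by (simp only: divide_pos_pos of_nat_0_less_iff zero_less_Suc times_divide_eq_right divide_divide_eq_right mult_1)
  qed
  then have "summable (\<lambda>n. S_term a (Suc n))" "S a = 2 * (\<Sum>n. \<Sum>m. h (Suc m * Suc n))"
    unfolding S_def using double(1) by (simp_all only: summable_mult suminf_mult)
  moreover have "\<forall>n\<ge>1. improper_integral_converges (cos_integrand a n)"
    unfolding integrand using assms by (intro allI impI improper_integral_converges_cos_shift) simp
  ultimately show ?thesis using double(2,3) by (simp add: h_def)
qed

end
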